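(* Let $A$ be a set of non-negative integers of cardinality $m \ge 1$ and let $n \ge 1$. Then the parity function on $A^n$ can be weakly sign represented by a polynomial $P(X_1,\ldots,X_n) \in \mathbb{R}[X_1,\ldots,X_n]$ of sparsity at most $\binom{n+m-1}{n}$ and total degree at most $n \cdot \binom{n+m-1}{n}$.
   Context: For $A \subseteq \mathbb{Z}$, the parity function $\mathrm{Par}: A^n \to \{0,1\}$ is $\mathrm{Par}(a_1,\ldots,a_n) = \sum_{i=1}^n a_i \bmod 2$. A polynomial $P$ weakly sign represents $f: A^n \to \{0,1\}$ if for every $a \in A^n$: $f(a) = 0 \Rightarrow P(a) \ge 0$ and $f(a) = 1 \Rightarrow P(a) \le 0$, and $P(a) \neq 0$ for at least one $a \in A^n$. The sparsity of $P$ is the number of monomials with nonzero coefficient in the standard monomial basis. *)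

theory Defs
  imports Complex_Main "HOL-Library.Poly_Mapping" "HOL-Library.FuncSet"
begin

text \<open>
  A polynomial in variables indexed by natural numbers is a finitely supported map from
  exponent vectors to coefficients; its set of \<open>keys\<close> is the set of monomials that
  occur with nonzero coefficient.
\<close>

type_synonym 'a mpoly = "(nat \<Rightarrow>\<^sub>0 nat) \<Rightarrow>\<^sub>0 'a"

definition polys_in :: "nat set \<Rightarrow> 'a::zero mpoly set" where
  "polys_in V = {P. \<forall>e\<in>Poly_Mapping.keys P. Poly_Mapping.keys e \<subseteq> V}"

definition eval_monom :: "(nat \<Rightarrow>\<^sub>0 nat) \<Rightarrow> (nat \<Rightarrow> 'a::comm_semiring_1) \<Rightarrow> 'a" where
  "eval_monom e x = (\<Prod>i\<in>Poly_Mapping.keys e. x i ^ Poly_Mapping.lookup e i)"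

definition eval_mpoly :: "'a::comm_semiring_1 mpoly \<Rightarrow> (nat \<Rightarrow> 'a) \<Rightarrow> 'a" where
  "eval_mpoly P x =
     (\<Sum>e\<in>Poly_Mapping.keys P. Poly_Mapping.lookup P e * eval_monom e x)"

definition sparsity :: "'a::zero mpoly \<Rightarrow> nat" where
  "sparsity P = card (Poly_Mapping.keys P)"

definition monom_degree :: "(nat \<Rightarrow>\<^sub>0 nat) \<Rightarrow> nat" where
  "monom_degree e = (\<Sum>i\<in>Poly_Mapping.keys e. Poly_Mapping.lookup e i)"

text \<open>The zero polynomial gets total degree 0.\<close>

definition total_degree :: "'a::zero mpoly \<Rightarrow> nat" where
  "total_degree P = Max (insert 0 (monom_degree ` Poly_Mapping.keys P))"

definition cube :: "int set \<Rightarrow> nat \<Rightarrow> (nat \<Rightarrow> int) set" where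
  "cube A n = {1..n} \<rightarrow>\<^sub>E A"

definition parity :: "nat \<Rightarrow> (nat \<Rightarrow> int) \<Rightarrow> int" where
  "parity n a = (\<Sum>i=1..n. a i) mod 2"

definition weakly_sign_represents ::
  "int set \<Rightarrow> nat \<Rightarrow> real mpoly \<Rightarrow> ((nat \<Rightarrow> int) \<Rightarrow> int) \<Rightarrow> bool" where
  "weakly_sign_represents A n P f \<longleftrightarrow>
     (\<forall>a\<in>cube A n.
        (f a = 0 \<longrightarrow> eval_mpoly P (\<lambda>i. real_of_int (a i)) \<ge> 0) \<and>
        (f a = 1 \<longrightarrow> eval_mpoly P (\<lambda>i. real_of_int (a i)) \<le> 0)) \<and>
     (\<exists>a\<in>cube A n. eval_mpoly P (\<lambda>i. real_of_int (a i)) \<noteq> 0)"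

end

theory Submission
  imports Defs "HOL-Library.Multiset" "HOL-Computational_Algebra.Polynomial"
begin

text \<open>
  The polynomial is univariate in the product \<open>X\<^sub>1 \<cdots> X\<^sub>n\<close>. Products of \<open>n\<close> elements of \<open>A\<close> are
  indexed by multisets, so they take at most \<open>(n + m - 1) choose n\<close> values, and the largest value
  \<open>(Max A)\<^sup>n\<close> is attained only at the constant point. A signed univariate polynomial
  vanishing at all the other values is therefore nonzero at a single point of the cube.
\<close>

definition prod_values :: "'a::comm_monoid_mult set \<Rightarrow> nat \<Rightarrow> 'a set" where
  "prod_values A n = (\<lambda>a. \<Prod>i=1..n. a i) ` ({1..n} \<rightarrow>\<^sub>E A)"

lemma finite_prod_values: "finite A \<Longrightarrow> finite (prod_values A n)"
  by (simp add: prod_values_def finite_PiE)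

lemma prod_valuesI:
  assumes "\<And>i. i \<in> {1..n} \<Longrightarrow> a i \<in> A"
  shows "(\<Prod>i=1..n. a i) \<in> prod_values A n"
proof -
  have "(\<Prod>i=1..n. a i) = (\<Prod>i=1..n. restrict a {1..n} i)" by simp
  then show ?thesis
    unfolding prod_values_def using assms by (intro image_eqI[of _ _ "restrict a {1..n}"]) auto
qed

text \<open>By commutativity a product depends only on the multiset of its factors, and stars and
  bars counts the multisets. Equality can fail, since different multisets may share a product, as in
  1 * 4 = 2 * 2.\<close>

lemma card_prod_values_le:
  assumes "finite A"
  shows "card (prod_values A n) \<le> (n + card A - 1) choose n"
proof -
  have "prod_values A n \<subseteq> prod_mset ` multisets_of_size A n"
  proof
    fix y assume "y \<in> prod_values A n"
    then obtain a where a: "a \<in> {1..n} \<rightarrow>\<^sub>E A" and y: "y = (\<Prod>i=1..n. a i)"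
      by (auto simp: prod_values_def)
    have "image_mset a (mset_set {1..n}) \<in> multisets_of_size A n"
      using a by (auto simp: multisets_of_size_def)
    then show "y \<in> prod_mset ` multisets_of_size A n"
      unfolding y prod_unfold_prod_mset by (rule imageI)
  qed
  then have "card (prod_values A n) \<le> card (multisets_of_size A n)"
    using assms by (intro surj_card_le finite_multisets_of_size)
  then show ?thesis
    using assms by (simp add: card_multisets_of_size add.commute)
qed

definition diag_monom :: "nat \<Rightarrow> nat \<Rightarrow> (nat \<Rightarrow>\<^sub>0 nat)" where
  "diag_monom n k = (\<Sum>i=1..n. Poly_Mapping.single i k)"

lemma lookup_diag_monom:
  "Poly_Mapping.lookup (diag_monom n k) i = (k when i \<in> {1..n})"
  by (simp add: diag_monom_def lookup_sum lookup_single when_def)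

lemma keys_diag_monom: "Poly_Mapping.keys (diag_monom n k) \<subseteq> {1..n}"
  by (auto simp: in_keys_iff lookup_diag_monom when_def split: if_splits)

lemma eval_diag_monom: "eval_monom (diag_monom n k) x = (\<Prod>i=1..n. x i) ^ k"
proof -
  have "eval_monom (diag_monom n k) x = (\<Prod>i=1..n. x i ^ Poly_Mapping.lookup (diag_monom n k) i)"
    unfolding eval_monom_def
    by (rule prod.mono_neutral_left) (use keys_diag_monom in \<open>auto simp: in_keys_iff\<close>)
  then show ?thesis by (simp add: lookup_diag_monom prod_power_distrib)
qed

lemma monom_degree_diag_monom: "monom_degree (diag_monom n k) \<le> n * k"
proof -
  have "monom_degree (diag_monom n k) \<le> (\<Sum>i=1..n. Poly_Mapping.lookup (diag_monom n k) i)"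
    unfolding monom_degree_def by (rule sum_mono2) (use keys_diag_monom in auto)
  then show ?thesis by (simp add: lookup_diag_monom)
qed

text \<open>This is \<open>p\<close> with the product of the variables \<open>1..n\<close>
  substituted for its variable: \<open>diag_monom n k\<close> is the exponent vector of the
  \<open>k\<close>-th power of that product.\<close>

definition diag_mpoly :: "nat \<Rightarrow> 'a::comm_semiring_1 poly \<Rightarrow> 'a mpoly" where
  "diag_mpoly n p = (\<Sum>k\<le>degree p. Poly_Mapping.single (diag_monom n k) (coeff p k))"

lemma keys_diag_mpoly: "Poly_Mapping.keys (diag_mpoly n p) \<subseteq> diag_monom n ` {..degree p}"
  unfolding diag_mpoly_def by (rule order_trans[OF keys_sum]) (auto split: if_splits)

lemma diag_mpoly_in_polys_in: "diag_mpoly n p \<in> polys_in {1..n}"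
  unfolding polys_in_def using keys_diag_mpoly[of n p] keys_diag_monom by blast

lemma sparsity_diag_mpoly: "sparsity (diag_mpoly n p) \<le> Suc (degree p)"
proof -
  have "sparsity (diag_mpoly n p) \<le> card (diag_monom n ` {..degree p})"
    unfolding sparsity_def by (intro card_mono keys_diag_mpoly) simp
  also have "\<dots> \<le> card {..degree p}" by (rule card_image_le) simp
  finally show ?thesis by simp
qed

lemma total_degree_diag_mpoly: "total_degree (diag_mpoly n p) \<le> n * degree p"
proof -
  have "monom_degree e \<le> n * degree p" if e: "e \<in> Poly_Mapping.keys (diag_mpoly n p)" for e
  proof -
    obtain k where "k \<le> degree p" "e = diag_monom n k"
      using subsetD[OF keys_diag_mpoly e] by auto
    then show ?thesis
      using monom_degree_diag_monom[of n k] by (meson le_trans mult_le_mono2)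
  qed
  then show ?thesis by (simp add: total_degree_def)
qed

lemma eval_diag_mpoly: "eval_mpoly (diag_mpoly n p) x = poly p (\<Prod>i=1..n. x i)"
proof -
  let ?S = "diag_monom n ` {..degree p}"
  have "eval_mpoly (diag_mpoly n p) x
      = (\<Sum>e\<in>?S. Poly_Mapping.lookup (diag_mpoly n p) e * eval_monom e x)"
    unfolding eval_mpoly_def
    by (rule sum.mono_neutral_left) (use keys_diag_mpoly in \<open>auto simp: in_keys_iff\<close>)
  \<comment> \<open>The coefficient at \<open>e\<close> is written as a sum over all
    \<open>k\<close> with \<open>diag_monom n k = e\<close>. Swapping the sums then works even for
    \<open>n = 0\<close>, where all these monomials coincide.\<close>
  also have "\<dots> = (\<Sum>e\<in>?S. \<Sum>k\<le>degree p.
      if diag_monom n k = e then coeff p k * eval_monom e x else 0)"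
    by (simp add: diag_mpoly_def lookup_sum lookup_single when_def sum_distrib_right
        if_distrib[of "\<lambda>c. c * _"] cong: if_cong)
  also have "\<dots> = (\<Sum>k\<le>degree p. \<Sum>e\<in>?S.
      if diag_monom n k = e then coeff p k * eval_monom e x else 0)"
    by (rule sum.swap)
  also have "\<dots> = (\<Sum>k\<le>degree p. coeff p k * (\<Prod>i=1..n. x i) ^ k)"
    by (intro sum.cong refl) (simp add: eval_diag_monom)
  finally show ?thesis by (simp add: poly_altdef)
qed

text \<open>All factors lie between 0 and the maximum, so one smaller factor makes the whole product
  smaller. Nonnegativity matters: for \<open>A = {-1, 1}\<close> the point (-1, -1) also has product
  1.\<close>

lemma prod_eq_Max_power_imp_const:
  fixes A :: "int set"
  assumes "\<forall>a\<in>A. a \<ge> 0" "finite A" "a \<in> {1..n} \<rightarrow> A" "(\<Prod>i=1..n. a i) = Max A ^ n"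
    and "i \<in> {1..n}"
  shows "a i = Max A"
proof (rule ccontr)
  assume neq: "a i \<noteq> Max A"
  have bounds: "0 \<le> a j \<and> a j \<le> Max A" if "j \<in> {1..n}" for j
    using assms that by (auto simp: Pi_iff)
  have "a i < Max A" using bounds[OF assms(5)] neq by simp
  \<comment> \<open>Positivity of \<open>Max A ^ (n - 1)\<close> is what keeps the inequality strict
    after multiplying by the other factors.\<close>
  moreover have "0 < Max A" using bounds[OF assms(5)] calculation by simp
  moreover have "prod a ({1..n} - {i}) \<le> Max A ^ (n - 1)"
    using prod_mono[of "{1..n} - {i}" a "\<lambda>_. Max A"] bounds assms(5) by simp
  ultimately have "a i * prod a ({1..n} - {i}) < Max A * Max A ^ (n - 1)"
    using bounds[OF assms(5)]
    by (intro le_less_trans[OF mult_left_mono mult_strict_right_mono]) auto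
  also have "\<dots> = Max A ^ n" using assms(5) by (cases n) auto
  finally show False using assms(4,5) by (simp add: prod.remove)
qed

theorem theorem4p2:
  fixes A :: "int set" and m n :: nat
  assumes "\<forall>a\<in>A. a \<ge> 0"
    and "finite A" and "card A = m" and "m \<ge> 1" and "n \<ge> 1"
  shows "\<exists>P :: real mpoly. P \<in> polys_in {1..n} \<and>
           weakly_sign_represents A n P (parity n) \<and>
           sparsity P \<le> (n + m - 1) choose n \<and>
           total_degree P \<le> n * ((n + m - 1) choose n)"
proof -
  have "A \<noteq> {}" using assms by auto
  define M where "M = Max A"
  have M: "M \<in> A" using assms \<open>A \<noteq> {}\<close> by (simp add: M_def)
  define Y where "Y = prod_values A n - {M ^ n}"
  have finY: "finite Y" using assms by (simp add: Y_def finite_prod_values)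
  define q :: "real poly" where "q = (\<Prod>y\<in>Y. [:- of_int y, 1:])"
  have q0: "poly q (of_int y) = 0 \<longleftrightarrow> y \<in> Y" for y
    using finY by (auto simp: q_def poly_prod)
  \<comment> \<open>The \<open>sgn\<close> factor turns the value of \<open>q\<close> at
    \<open>M ^ n\<close> into its absolute value; the other factor gives it the sign that the parity
    of the constant point demands.\<close>
  define c :: real where
    "c = (if parity n (\<lambda>i. M) = 0 then 1 else - 1) * sgn (poly q (of_int (M ^ n)))"
  have c0: "c \<noteq> 0" using q0[of "M ^ n"] by (auto simp: c_def Y_def sgn_0_0)
  define P where "P = diag_mpoly n (smult c q)"
  have eval: "eval_mpoly P (\<lambda>i. real_of_int (a i)) = c * poly q (of_int (\<Prod>i=1..n. a i))" for a
    by (simp add: P_def eval_diag_mpoly)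

  \<comment> \<open>Leaving out this one value makes the degree one less than the number of values.
    A polynomial of degree d has up to d + 1 coefficients, so the sparsity bound comes out
    exactly.\<close>
  have "M ^ n \<in> prod_values A n"
    using prod_valuesI[of n "\<lambda>_. M" A] M by simp
  then have "Suc (card Y) = card (prod_values A n)"
    using assms by (simp add: Y_def finite_prod_values card_Suc_Diff1 del: card_Diff_insert)
  moreover have "degree (smult c q) = card Y"
    using c0 by (simp add: q_def degree_prod_eq_sum_degree)
  ultimately have deg: "Suc (degree (smult c q)) \<le> (n + m - 1) choose n"
    using card_prod_values_le[of A n] assms by simp

  have zero: "eval_mpoly P (\<lambda>i. real_of_int (a i)) = 0"
    if "a \<in> cube A n" "(\<Prod>i=1..n. a i) \<noteq> M ^ n" for a
    using that q0[of "\<Prod>i=1..n. a i"] unfolding eval by (auto simp: Y_def prod_values_def cube_def)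
  have "(parity n a = 0 \<longrightarrow> eval_mpoly P (\<lambda>i. real_of_int (a i)) \<ge> 0) \<and>
        (parity n a = 1 \<longrightarrow> eval_mpoly P (\<lambda>i. real_of_int (a i)) \<le> 0)"
    if a: "a \<in> cube A n" for a
  proof (cases "(\<Prod>i=1..n. a i) = M ^ n")
    case True
    then have "\<And>i. i \<in> {1..n} \<Longrightarrow> a i = M"
      using prod_eq_Max_power_imp_const[of A a n] a assms by (auto simp: M_def cube_def PiE_def)
    \<comment> \<open>Only the coordinates in \<open>{1..n}\<close> enter \<open>parity\<close>, so
      it does not matter that \<open>a\<close> is \<open>undefined\<close> elsewhere.\<close>
    then have "parity n a = parity n (\<lambda>i. M)"
      by (simp add: parity_def)
    then show ?thesis
      unfolding eval True by (simp add: c_def mult.commute[of "sgn _"] flip: abs_sgn)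
  qed (use zero[OF a] in simp)
  moreover have "\<exists>a\<in>cube A n. eval_mpoly P (\<lambda>i. real_of_int (a i)) \<noteq> 0"
  proof
    show "restrict (\<lambda>_. M) {1..n} \<in> cube A n" using M by (auto simp: cube_def)
    \<comment> \<open>The product here is \<open>M ^ n\<close>, which was removed from
      \<open>Y\<close> and so is not a root of \<open>q\<close>.\<close>
    show "eval_mpoly P (\<lambda>i. real_of_int (restrict (\<lambda>_. M) {1..n} i)) \<noteq> 0"
      using c0 q0[of "M ^ n"] unfolding eval by (simp add: Y_def)
  qed
  ultimately have "weakly_sign_represents A n P (parity n)"
    by (simp add: weakly_sign_represents_def)
  moreover have "total_degree P \<le> n * ((n + m - 1) choose n)"
    unfolding P_def using deg
    by (meson Suc_leD le_trans mult_le_mono2 total_degree_diag_mpoly)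
  moreover have "sparsity P \<le> (n + m - 1) choose n"
    unfolding P_def using deg sparsity_diag_mpoly by (rule order_trans[rotated])
  ultimately show ?thesis
    using diag_mpoly_in_polys_in unfolding P_def by blast
qed

end
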